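(* Let $R$ be a ring, $n \ge 1$ an integer, and $I$ an index set (possibly infinite). For any collection of matrices $\{A_i \mid i \in I\} \subseteq M_n(R)$, consider, for each integer $j \ge 0$, the ideal of $R$ \[ I_j := \left( \det\left( \sum_{i \in S} A_i \right) \;\Big|\; S \subseteq I,\ |S| \le j \right). \] Then $0 = I_0 \subseteq I_1 \subseteq \cdots \subseteq I_n = I_{n+1} = \cdots$ is an ascending chain of ideals which stabilizes at position $n$; that is, $I_0 = 0$, $I_j \subseteq I_{j+1}$ for all $j \ge 0$, and $I_j = I_n$ for all $j \ge n$.
   Context: All rings, except for matrix rings, are commutative with $1 \ne 0$. $M_n(R)$ is the ring of $n \times n$ matrices over $R$. $|S|$ denotes the cardinality of $S$; the sum over $S = \emptyset$ is the zero matrix. The notation $( \cdots )$ denotes the ideal of $R$ generated by the listed elements. *)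

theory Defs
  imports "HOL-Analysis.Determinants" "HOL-Algebra.Ideal"
begin

(* The record view of a type-class ring. It is needed because determinants are only available for
   matrices over a type-class ring, whereas ideals are only available for ring records. *)
definition type_ring :: "'a::comm_ring_1 ring"
  where "type_ring = \<lparr>carrier = UNIV, mult = (*), one = 1, zero = 0, add = (+)\<rparr>"

lemma type_ring_simps [simp]:
  "carrier type_ring = UNIV"
  "x \<otimes>\<^bsub>type_ring\<^esub> y = x * y"
  "\<one>\<^bsub>type_ring\<^esub> = 1"
  "\<zero>\<^bsub>type_ring\<^esub> = 0"
  "x \<oplus>\<^bsub>type_ring\<^esub> y = x + y"
  by (simp_all add: type_ring_def)

lemma cring_type_ring: "cring (type_ring :: 'a::comm_ring_1 ring)"
proof (rule cringI)
  show "abelian_group (type_ring :: 'a ring)"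
  proof (rule abelian_groupI)
    fix x :: 'a
    show "\<exists>y\<in>carrier type_ring. y \<oplus>\<^bsub>type_ring\<^esub> x = \<zero>\<^bsub>type_ring\<^esub>"
      by (intro bexI[of _ "- x"]) auto
  qed (auto simp: algebra_simps)
  show "comm_monoid (type_ring :: 'a ring)"
    by (rule comm_monoidI) (auto simp: algebra_simps)
qed (auto simp: algebra_simps)

(* "finite S" is explicit since the cardinality of an infinite set is 0. *)
definition det_sum_ideal ::
    "('i \<Rightarrow> 'a::comm_ring_1 ^ 'n::finite ^ 'n) \<Rightarrow> 'i set \<Rightarrow> nat \<Rightarrow> 'a set"
  where "det_sum_ideal A I j =
    Idl\<^bsub>type_ring\<^esub> {det (\<Sum>i\<in>S. A i) | S. S \<subseteq> I \<and> finite S \<and> card S \<le> j}"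

end

theory Submission
  imports Defs
begin

(* The determinant of a sum over S is a polynomial of degree n in the indicator of S, so the
   alternating sum of det (\<Sum>i\<in>T. A i) over all T \<subseteq> S vanishes as soon as |S| > n. This
   writes the determinant belonging to S through those of its proper subsets. *)

text \<open>The lower bound \<open>U\<close> on \<open>T\<close> is what makes the induction on \<open>N\<close> work: expanding one
  factor forces one more index into \<open>U\<close>.\<close>

lemma alternating_sum_prod_sum_eq_0:
  fixes g :: "'b \<Rightarrow> 'i \<Rightarrow> 'a::comm_ring_1"
  assumes "finite N" "finite S" "U \<subseteq> S" "card U + card N < card S"
  shows "(\<Sum>T | U \<subseteq> T \<and> T \<subseteq> S. (-1) ^ card T * (\<Prod>i\<in>N. \<Sum>s\<in>T. g i s)) = 0"
  using assms(1,3,4)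
proof (induction N arbitrary: U rule: finite_induct)
  case empty
  then have "U \<subset> S" by auto
  \<comment> \<open>The sets between \<open>U\<close> and \<open>S\<close> correspond to the subsets
    of the nonempty set \<open>S - U\<close>, half of which have even and half odd cardinality, so
    the signs cancel.\<close>
  with \<open>finite S\<close> have "(\<Sum>T | U \<subseteq> T \<and> T \<subseteq> S. (-1) ^ card T) = (0::'a)"
    using card_subsupersets_even_odd[of S U]
    by (intro sum_alternating_cancels) (auto simp: conj_ac)
  then show ?case by simp
next
  case (insert k N)
  let ?t = "\<lambda>T. (-1) ^ card T * (\<Prod>i\<in>N. \<Sum>s\<in>T. g i s)"
  have fin: "finite {T. U \<subseteq> T \<and> T \<subseteq> S}" using \<open>finite S\<close> by simp
  \<comment> \<open>The factor for \<open>k\<close> is expanded. Writing its index range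
    \<open>T\<close> as the part of \<open>S\<close> lying in \<open>T\<close> gives the form needed
    to exchange the two sums.\<close>
  have "(\<Sum>T | U \<subseteq> T \<and> T \<subseteq> S. (-1) ^ card T * (\<Prod>i\<in>insert k N. \<Sum>s\<in>T. g i s)) =
      (\<Sum>T | U \<subseteq> T \<and> T \<subseteq> S. \<Sum>s | s \<in> S \<and> s \<in> T. g k s * ?t T)"
  proof (intro sum.cong refl)
    fix T assume "T \<in> {T. U \<subseteq> T \<and> T \<subseteq> S}"
    then have T: "{s. s \<in> S \<and> s \<in> T} = T" by auto
    show "(-1) ^ card T * (\<Prod>i\<in>insert k N. \<Sum>s\<in>T. g i s) =
        (\<Sum>s | s \<in> S \<and> s \<in> T. g k s * ?t T)"
      unfolding T using insert.hyps by (simp add: sum_distrib_right [symmetric] ac_simps)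
  qed
  also have "\<dots> = (\<Sum>s\<in>S. \<Sum>T | T \<in> {T. U \<subseteq> T \<and> T \<subseteq> S} \<and> s \<in> T. g k s * ?t T)"
    by (rule sum.swap_restrict [OF fin \<open>finite S\<close>])
  \<comment> \<open>For fixed \<open>s\<close> the conditions \<open>U \<subseteq> T\<close> and
    \<open>s \<in> T\<close> merge into one lower bound on \<open>T\<close>.\<close>
  also have "\<dots> = (\<Sum>s\<in>S. g k s * (\<Sum>T | insert s U \<subseteq> T \<and> T \<subseteq> S. ?t T))"
    by (simp add: sum_distrib_left conj_ac)
  also have "\<dots> = 0"
  proof (intro sum.neutral ballI)
    fix s assume "s \<in> S"
    \<comment> \<open>Only an inequality, since \<open>s\<close> may already lie in
      \<open>U\<close>. The possible gain of one is paid for by the removal of \<open>k\<close> from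
      the product.\<close>
    have "card (insert s U) \<le> Suc (card U)"
      by (simp add: card_insert_le_m1)
    with insert.hyps insert.prems \<open>s \<in> S\<close> have "card (insert s U) + card N < card S"
      by simp
    with insert.IH [of "insert s U"] insert.prems \<open>s \<in> S\<close>
    show "g k s * (\<Sum>T | insert s U \<subseteq> T \<and> T \<subseteq> S. ?t T) = 0"
      by simp
  qed
  finally show ?case .
qed

text \<open>By the Leibniz formula each permutation contributes a product of \<open>CARD('n)\<close>
  entries, and each entry is a sum over \<open>T\<close>. The preceding lemma with
  \<open>U = {}\<close> kills these contributions one permutation at a time.\<close>

lemma alternating_sum_det_sum_eq_0:
  fixes A :: "'i \<Rightarrow> 'a::comm_ring_1 ^ 'n::finite ^ 'n"
  assumes "finite S" "CARD('n) < card S"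
  shows "(\<Sum>T\<in>Pow S. (-1) ^ card T * det (\<Sum>i\<in>T. A i)) = 0"
proof -
  let ?P = "{p. p permutes (UNIV :: 'n set)}"
  have "(\<Sum>T\<in>Pow S. (-1) ^ card T * det (\<Sum>i\<in>T. A i)) =
      (\<Sum>T\<in>Pow S. \<Sum>p\<in>?P. of_int (sign p) * ((-1) ^ card T * (\<Prod>i\<in>UNIV. \<Sum>s\<in>T. A s $ i $ p i)))"
    by (simp add: det_def sum_distrib_left sum_component mult.left_commute)
  also have "\<dots> = (\<Sum>p\<in>?P. of_int (sign p) *
      (\<Sum>T\<in>Pow S. (-1) ^ card T * (\<Prod>i\<in>UNIV. \<Sum>s\<in>T. A s $ i $ p i)))"
    by (subst sum.swap) (simp add: sum_distrib_left)
  also have "\<dots> = 0"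
  proof (intro sum.neutral ballI)
    fix p
    show "of_int (sign p) *
        (\<Sum>T\<in>Pow S. (-1) ^ card T * (\<Prod>i\<in>UNIV. \<Sum>s\<in>T. A s $ i $ p i)) = 0"
      using alternating_sum_prod_sum_eq_0 [of UNIV S "{}" "\<lambda>i s. A s $ i $ p i"] assms
      by (simp add: Pow_def)
  qed
  finally show ?thesis .
qed

lemma sum_mult_mem_ideal:
  fixes J :: "'a::comm_ring_1 set"
  assumes "ideal J type_ring" "\<And>x. x \<in> X \<Longrightarrow> f x \<in> J"
  shows "(\<Sum>x\<in>X. c x * f x) \<in> J"
proof -
  interpret ideal J "type_ring :: 'a ring" by fact
  show ?thesis
    using assms(2) additive_subgroup.zero_closed [OF is_additive_subgroup]
      additive_subgroup.a_closed [OF is_additive_subgroup] I_l_closed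
    \<comment> \<open>For infinite \<open>X\<close> the sum is 0 by convention, which also lies in
      \<open>J\<close>.\<close>
    by (induction X rule: infinite_finite_induct) auto
qed

lemma ideal_det_sum_ideal:
  fixes A :: "'i \<Rightarrow> 'a::comm_ring_1 ^ 'n::finite ^ 'n"
  shows "ideal (det_sum_ideal A I j) type_ring"
proof -
  interpret cring "type_ring :: 'a ring" by (rule cring_type_ring)
  show ?thesis unfolding det_sum_ideal_def by (rule genideal_ideal) simp
qed

lemma det_mem_det_sum_ideal:
  fixes A :: "'i \<Rightarrow> 'a::comm_ring_1 ^ 'n::finite ^ 'n"
  assumes "S \<subseteq> I" "finite S" "card S \<le> j"
  shows "det (\<Sum>i\<in>S. A i) \<in> det_sum_ideal A I j"
proof -
  interpret cring "type_ring :: 'a ring" by (rule cring_type_ring)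
  have "{det (\<Sum>i\<in>S. A i) | S. S \<subseteq> I \<and> finite S \<and> card S \<le> j} \<subseteq> det_sum_ideal A I j"
    unfolding det_sum_ideal_def by (rule genideal_self) simp
  with assms show ?thesis by blast
qed

lemma det_sum_ideal_subset:
  fixes A :: "'i \<Rightarrow> 'a::comm_ring_1 ^ 'n::finite ^ 'n"
  assumes "ideal J type_ring"
    and "\<And>S. S \<subseteq> I \<Longrightarrow> finite S \<Longrightarrow> card S \<le> j \<Longrightarrow> det (\<Sum>i\<in>S. A i) \<in> J"
  shows "det_sum_ideal A I j \<subseteq> J"
proof -
  interpret cring "type_ring :: 'a ring" by (rule cring_type_ring)
  show ?thesis
    unfolding det_sum_ideal_def using assms by (intro genideal_minimal) auto
qed

lemma det_sum_ideal_mono: "j \<le> k \<Longrightarrow> det_sum_ideal A I j \<subseteq> det_sum_ideal A I k"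
  by (intro det_sum_ideal_subset ideal_det_sum_ideal det_mem_det_sum_ideal) auto

lemma det_sum_ideal_0:
  fixes A :: "'i \<Rightarrow> 'a::comm_ring_1 ^ 'n::finite ^ 'n"
  shows "det_sum_ideal A I 0 = {0}"
proof -
  interpret cring "type_ring :: 'a ring" by (rule cring_type_ring)
  \<comment> \<open>This uses that the size is at least 1: index types are nonempty, so every
    Leibniz term has a zero factor.\<close>
  have "det (0 :: 'a ^ 'n ^ 'n) = 0"
    by (simp add: det_def power_0_left)
  then have "{det (\<Sum>i\<in>S. A i) | S. S \<subseteq> I \<and> finite S \<and> card S \<le> 0} = {0}"
    by auto (metis card.empty empty_subsetI finite.emptyI sum.empty)
  then show ?thesis
    unfolding det_sum_ideal_def using genideal_zero by simp
qed

text \<open>Only generators with \<open>card S = Suc j\<close> are new, and the bound on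
  \<open>j\<close> makes such \<open>S\<close> large enough for
  \<open>alternating_sum_det_sum_eq_0\<close>.\<close>

lemma det_sum_ideal_Suc:
  fixes A :: "'i \<Rightarrow> 'a::comm_ring_1 ^ 'n::finite ^ 'n"
  assumes "CARD('n) \<le> j"
  shows "det_sum_ideal A I (Suc j) = det_sum_ideal A I j"
proof
  show "det_sum_ideal A I (Suc j) \<subseteq> det_sum_ideal A I j"
  proof (rule det_sum_ideal_subset [OF ideal_det_sum_ideal])
    fix S assume S: "S \<subseteq> I" "finite S" "card S \<le> Suc j"
    show "det (\<Sum>i\<in>S. A i) \<in> det_sum_ideal A I j"
    proof (cases "card S \<le> j")
      case True
      with S show ?thesis by (intro det_mem_det_sum_ideal)
    next
      case False
      let ?d = "\<lambda>T. det (\<Sum>i\<in>T. A i)"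
      have "(-1) ^ card S * ?d S + (\<Sum>T\<in>Pow S - {S}. (-1) ^ card T * ?d T) = 0"
        using alternating_sum_det_sum_eq_0 [of S A] False S(2) assms
        by (simp add: sum.remove [of "Pow S" S])
      then have "(-1) ^ card S * ?d S = - (\<Sum>T\<in>Pow S - {S}. (-1) ^ card T * ?d T)"
        by (simp add: eq_neg_iff_add_eq_0)
      \<comment> \<open>The sign squares to 1, so multiplying by it once more isolates
        \<open>?d S\<close>.\<close>
      then have "(-1) ^ card S * ((-1) ^ card S * ?d S) =
          (-1) ^ card S * - (\<Sum>T\<in>Pow S - {S}. (-1) ^ card T * ?d T)"
        by simp
      then have "?d S = (\<Sum>T\<in>Pow S - {S}. (- ((-1) ^ card S * (-1) ^ card T)) * ?d T)"
        by (simp add: sum_distrib_left sum_negf mult.assoc flip: mult.assoc power_add)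
      also have "\<dots> \<in> det_sum_ideal A I j"
      proof (intro sum_mult_mem_ideal ideal_det_sum_ideal det_mem_det_sum_ideal)
        fix T assume "T \<in> Pow S - {S}"
        then have T: "T \<subset> S" by auto
        with S show "T \<subseteq> I" "finite T" by (auto intro: finite_subset)
        \<comment> \<open>A proper subset loses at least one element, which is exactly the step from
          \<open>Suc j\<close> down to \<open>j\<close>.\<close>
        from psubset_card_mono [OF S(2) T] S(3) show "card T \<le> j" by simp
      qed
      finally show ?thesis .
    qed
  qed
qed (simp add: det_sum_ideal_mono)

theorem proposition4:
  fixes A :: "'i \<Rightarrow> 'a::comm_ring_1 ^ 'n::finite ^ 'n"
    and I :: "'i set"
  shows "(\<forall>j. ideal (det_sum_ideal A I j) type_ring) \<and>
    det_sum_ideal A I 0 = {0} \<and>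
    (\<forall>j. det_sum_ideal A I j \<subseteq> det_sum_ideal A I (Suc j)) \<and>
    (\<forall>j\<ge>CARD('n). det_sum_ideal A I j = det_sum_ideal A I CARD('n))"
proof (intro conjI allI impI)
  fix j assume "CARD('n) \<le> j"
  then show "det_sum_ideal A I j = det_sum_ideal A I CARD('n)"
    by (induction j rule: dec_induct) (simp_all add: det_sum_ideal_Suc)
qed (simp_all add: ideal_det_sum_ideal det_sum_ideal_0 det_sum_ideal_mono)

end
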